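(* Let $SG=\mathcal{L}_{1}\cup\mathcal{L}_{1}^{T}$, where $\mathcal{L}_{1}=\left\{\begin{bmatrix} I & S \\ 0 & I\end{bmatrix} : S\in\mathbb{R}^{d\times d},\ S^T=S\right\}$ and $\mathcal{L}_{1}^{T}=\{H^{T} : H\in\mathcal{L}_{1}\}$. Then $SG$ is a set of generators of the group $SP$ of symplectic $2d\times 2d$ real matrices.
   Context: Let $I=I_d$ and $J=\begin{bmatrix} 0 & I_{d} \\ -I_{d} & 0 \end{bmatrix}$. A matrix $H\in\mathbb{R}^{2d\times 2d}$ is symplectic if $H^{T}JH=J$; $SP$ is the group of all such matrices under multiplication. *)

theory Defs
  imports
    "Jordan_Normal_Form.Matrix"
    "HOL-Algebra.Generated_Groups"
begin

definition J_mat :: "nat \<Rightarrow> real mat" where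
  "J_mat d = four_block_mat (0\<^sub>m d d) (1\<^sub>m d) (- 1\<^sub>m d) (0\<^sub>m d d)"

definition symplectic :: "nat \<Rightarrow> real mat \<Rightarrow> bool" where
  "symplectic d H \<longleftrightarrow>
     H \<in> carrier_mat (2 * d) (2 * d) \<and> transpose_mat H * J_mat d * H = J_mat d"

definition SP :: "nat \<Rightarrow> real mat monoid" where
  "SP d = \<lparr>carrier = {H. symplectic d H}, mult = (*), one = 1\<^sub>m (2 * d)\<rparr>"

definition L1 :: "nat \<Rightarrow> real mat set" where
  "L1 d = {four_block_mat (1\<^sub>m d) S (0\<^sub>m d d) (1\<^sub>m d) | S.
             S \<in> carrier_mat d d \<and> transpose_mat S = S}"

definition SG :: "nat \<Rightarrow> real mat set" where
  "SG d = L1 d \<union> transpose_mat ` L1 d"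

end

theory Submission
  imports Defs "Jordan_Normal_Form.Determinant"
begin

text \<open>
  Write \<open>U(S) = [[I, S], [0, I]]\<close> and \<open>L(S) = [[I, 0], [S, I]]\<close>. The identity
  \<open>U(S) L(-S\<^sup>-\<^sup>1) U(S) = [[0, S], [-S\<^sup>-\<^sup>1, 0]]\<close> for invertible symmetric \<open>S\<close>, multiplied
  by its instance \<open>S = -I\<close>, puts \<open>diag(S, S\<^sup>-\<^sup>1)\<close> into the generated group. Every invertible \<open>P\<close> is a
  product of symmetric invertible matrices, so \<open>diag(P, P\<^sup>-\<^sup>T)\<close> is generated as well. A symplectic
  \<open>[[A, B], [C, D]]\<close> with \<open>A\<close> invertible is then \<open>L(C A\<^sup>-\<^sup>1) diag(A, A\<^sup>-\<^sup>T) U(A\<^sup>-\<^sup>1 B)\<close>, and the general case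
  reduces to this one since \<open>A + t C\<close>, the corner of \<open>U(t I) H\<close>, is invertible for some real \<open>t\<close>.
\<close>

section \<open>Invertible matrices as products of symmetric ones\<close>

lemma transpose_swaprows_mat: "transpose_mat (swaprows_mat n k l) = swaprows_mat n k l"
  by (rule eq_matI) auto

lemma transpose_multrow_mat: "transpose_mat (multrow_mat n k a) = multrow_mat n k a"
  by (rule eq_matI) auto

lemma swaprows_mat_self: "swaprows_mat n k k = 1\<^sub>m n"
  by (rule eq_matI) auto

lemma det_swaprows_mat_nonzero:
  assumes "k < n" "l < n"
  shows "det (swaprows_mat n k l :: 'a :: field mat) \<noteq> 0"
  using det_swaprows_mat[OF assms, where 'a = 'a] by (cases "k = l") (auto simp: swaprows_mat_self)

text \<open>On the indices \<open>k\<close>, \<open>l\<close> the product is the symmetric block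
  [[a, 1], [1, 0]]; elsewhere it is the identity. This lets a transvection be written with symmetric
  factors.\<close>

lemma transpose_addrow_swaprows:
  fixes a :: "'a :: field"
  assumes "k < n" "l < n" "k \<noteq> l"
  shows "transpose_mat (addrow_mat n a k l * swaprows_mat n k l) = addrow_mat n a k l * swaprows_mat n k l"
proof -
  have "addrow_mat n a k l * swaprows_mat n k l = addrow a k l (swaprows_mat n k l)"
    using assms by (intro addrow_mat[symmetric]) auto
  moreover have "transpose_mat (addrow a k l (swaprows_mat n k l)) = addrow a k l (swaprows_mat n k l)"
    using assms by (intro eq_matI) auto
  ultimately show ?thesis by simp
qed

text \<open>Keeping \<open>K\<close> abstract replaces explicit factorizations by closure
  properties. The instance needed later consists of the matrices P for which diag(P, P^-T) is
  generated.\<close>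

locale symmetric_product_closed =
  fixes n :: nat and K :: "'a :: field mat set"
  assumes mult_closed: "A \<in> K \<Longrightarrow> B \<in> K \<Longrightarrow> A * B \<in> K"
    and symmetric_in: "S \<in> carrier_mat n n \<Longrightarrow> transpose_mat S = S \<Longrightarrow> det S \<noteq> 0 \<Longrightarrow> S \<in> K"
begin

lemma one_in: "1\<^sub>m n \<in> K"
  by (rule symmetric_in) auto

lemma swaprows_mat_in: "k < n \<Longrightarrow> l < n \<Longrightarrow> swaprows_mat n k l \<in> K"
  by (intro symmetric_in) (auto simp: transpose_swaprows_mat det_swaprows_mat_nonzero)

lemma multrow_mat_in: "k < n \<Longrightarrow> a \<noteq> 0 \<Longrightarrow> multrow_mat n k a \<in> K"
  by (intro symmetric_in) (auto simp: transpose_multrow_mat det_multrow_mat)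

text \<open>A transvection is the product of the symmetric matrix of \<open>transpose_addrow_swaprows\<close> with a swap.\<close>

lemma addrow_mat_in:
  assumes "k < n" "l < n" "k \<noteq> l"
  shows "addrow_mat n a k l \<in> K"
proof -
  let ?E = "addrow_mat n a k l" and ?T = "swaprows_mat n k l :: 'a mat"
  have "?E * ?T \<in> K"
    using assms
    by (intro symmetric_in)
      (auto simp: transpose_addrow_swaprows det_mult[of _ n] det_addrow_mat det_swaprows_mat_nonzero)
  then have "?E * ?T * ?T \<in> K"
    using assms by (auto intro!: mult_closed[of _ ?T] swaprows_mat_in)
  also have "?E * ?T * ?T = ?E * (?T * ?T)"
    by (rule assoc_mult_mat[of _ n n _ n _ n]) auto
  also have "\<dots> = ?E"
    using assms by (simp add: swaprows_mat_inv right_mult_one_mat[of _ n n])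
  finally show ?thesis .
qed

text \<open>Closure of \<open>K\<close> under inverses is not assumed, so a row operation is undone
  by an explicit inverse \<open>E'\<close> that itself lies in \<open>K\<close>.\<close>

lemma cancel_in:
  assumes "E' \<in> K" "E' * E = 1\<^sub>m n" "E \<in> carrier_mat n n" "E' \<in> carrier_mat n n" "P \<in> carrier_mat n n" "E * P \<in> K"
  shows "P \<in> K"
proof -
  have "E' * (E * P) \<in> K" using assms by (simp add: mult_closed)
  also have "E' * (E * P) = P"
    using assms by (simp add: assoc_mult_mat[symmetric, of _ n n _ n _ n])
  finally show ?thesis .
qed

lemma addrow_cancel_in:
  assumes "P \<in> carrier_mat n n" "k < n" "l < n" "k \<noteq> l" "addrow a k l P \<in> K"
  shows "P \<in> K"
proof (rule cancel_in)
  show "addrow_mat n (-a) k l \<in> K" using assms by (intro addrow_mat_in)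
  show "addrow_mat n (-a) k l * addrow_mat n a k l = 1\<^sub>m n"
    using addrow_mat_inv[of k n l "-a"] assms by simp
  show "addrow_mat n a k l * P \<in> K" using assms addrow_mat[of P n n l a k] by simp
qed (use assms in auto)

lemma multrow_cancel_in:
  assumes "P \<in> carrier_mat n n" "k < n" "a \<noteq> 0" "multrow k a P \<in> K"
  shows "P \<in> K"
proof (rule cancel_in)
  show "multrow_mat n k (inverse a) \<in> K" using assms by (intro multrow_mat_in) auto
  show "multrow_mat n k (inverse a) * multrow_mat n k a = 1\<^sub>m n"
    using multrow_mat_inv[of k n "inverse a"] assms by simp
  show "multrow_mat n k a * P \<in> K" using assms multrow_mat[of P n n k a] by simp
qed (use assms in auto)

lemma swaprows_cancel_in:
  assumes "P \<in> carrier_mat n n" "k < n" "l < n" "swaprows k l P \<in> K"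
  shows "P \<in> K"
proof (rule cancel_in)
  show "swaprows_mat n k l \<in> K" using assms by (intro swaprows_mat_in)
  show "swaprows_mat n k l * swaprows_mat n k l = 1\<^sub>m n" using assms by (intro swaprows_mat_inv)
  show "swaprows_mat n k l * P \<in> K" using assms swaprows_mat[of P n n k l] by simp
qed (use assms in auto)

text \<open>Gauss-Jordan elimination, with the first \<open>k\<close> columns already reduced to
  unit vectors. The induction descends from \<open>k = n\<close>, where only the identity is left; a
  step reduces column \<open>k\<close> by row operations that the cancellation lemmas undo inside
  \<open>K\<close>.\<close>

lemma invertible_in_aux:
  assumes "k \<le> n" "P \<in> carrier_mat n n" "det P \<noteq> 0"
    "\<And>i j. i < n \<Longrightarrow> j < k \<Longrightarrow> P $$ (i,j) = (if i = j then 1 else 0)"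
  shows "P \<in> K"
  using assms
proof (induction arbitrary: P rule: inc_induct)
  case base
  then have "P = 1\<^sub>m n" by (intro eq_matI) auto
  then show ?case by (simp add: one_in)
next
  case (step k)
  \<comment> \<open>Once the pivot is 1, the other nonzero entries of column \<open>k\<close> are
    removed one row at a time, by induction on the set \<open>M\<close> of their rows. Row
    \<open>k\<close> is zero in the earlier columns, so these stay reduced.\<close>
  have clear: "P \<in> K" if "finite M" "M = {i. i < n \<and> i \<noteq> k \<and> P $$ (i,k) \<noteq> 0}" "P $$ (k,k) = 1"
    "P \<in> carrier_mat n n" "det P \<noteq> 0"
    "\<And>i j. i < n \<Longrightarrow> j < k \<Longrightarrow> P $$ (i,j) = (if i = j then 1 else 0)" for M P
    using that
  proof (induction M arbitrary: P rule: finite_induct)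
    case empty
    then show ?case by (intro step.IH) (auto simp: less_Suc_eq)
  next
    case (insert r M)
    have r: "r < n" "r \<noteq> k" using insert.prems by auto
    let ?P = "addrow (- (P $$ (r,k))) r k P"
    have "?P \<in> K"
    proof (rule insert.IH)
      show "M = {i. i < n \<and> i \<noteq> k \<and> ?P $$ (i,k) \<noteq> 0}"
      proof -
        have "{i. i < n \<and> i \<noteq> k \<and> ?P $$ (i,k) \<noteq> 0} = {i. i < n \<and> i \<noteq> k \<and> P $$ (i,k) \<noteq> 0} - {r}"
          using r insert.prems step.hyps by auto
        then show ?thesis using insert.prems(1) insert.hyps by auto
      qed
      show "?P $$ (k,k) = 1" using r insert.prems step.hyps by auto
      show "det ?P \<noteq> 0" using r insert.prems step.hyps by (simp add: det_addrow[of _ n])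
    qed (use r insert.prems step.hyps in auto)
    then show ?case using r insert.prems step.hyps by (intro addrow_cancel_in[of P r k]) auto
  qed
  have scale: "P \<in> K" if "P $$ (k,k) \<noteq> 0" "P \<in> carrier_mat n n" "det P \<noteq> 0"
    "\<And>i j. i < n \<Longrightarrow> j < k \<Longrightarrow> P $$ (i,j) = (if i = j then 1 else 0)" for P
  proof -
    have "multrow k (inverse (P $$ (k,k))) P \<in> K"
      by (rule clear[OF _ refl]) (use that step.hyps in \<open>auto simp: det_multrow[of _ n]\<close>)
    then show ?thesis using that step.hyps by (intro multrow_cancel_in[of P k]) auto
  qed
  have "\<exists>r. k \<le> r \<and> r < n \<and> P $$ (r,k) \<noteq> 0"
  proof (rule ccontr)
    assume no: "\<not> ?thesis"
    \<comment> \<open>If column \<open>k\<close> vanishes from row \<open>k\<close> on, it is a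
      combination of the earlier columns, which are unit vectors. The entries of \<open>v\<close>
      record this dependence, and the entry 1 at \<open>k\<close> makes \<open>v\<close>
      nonzero.\<close>
    define v where "v = vec n (\<lambda>j. if j < k then - P $$ (j,k) else if j = k then 1 else 0)"
    have v: "v \<in> carrier_vec n" "v \<noteq> 0\<^sub>v n"
      using step.hyps by (auto simp: v_def vec_eq_iff)
    have "P *\<^sub>v v = 0\<^sub>v n"
    proof (rule eq_vecI)
      fix i assume i: "i < dim_vec (0\<^sub>v n)"
      have "(P *\<^sub>v v) $ i = (\<Sum>j\<in>{0..<n}. P $$ (i,j) * v $ j)"
        using i step.prems v by (simp add: scalar_prod_def)
      also have "\<dots> = (\<Sum>j\<in>{0..<n}. (if j = i \<and> i < k then - P $$ (i,k) else 0)
          + (if j = k then P $$ (i,k) else 0))"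
        using i step.prems by (intro sum.cong) (auto simp: v_def)
      also have "\<dots> = (if i < k then - P $$ (i,k) else 0) + P $$ (i,k)"
        using i step.hyps by (auto simp: sum.distrib)
      also have "\<dots> = 0" using no i by auto
      finally show "(P *\<^sub>v v) $ i = 0\<^sub>v n $ i" using i by simp
    qed (use step.prems in auto)
    then show False using v step.prems det_0_iff_vec_prod_zero_field[of P n] by blast
  qed
  then obtain r where r: "k \<le> r" "r < n" "P $$ (r,k) \<noteq> 0" by blast
  \<comment> \<open>Rows \<open>k\<close> and \<open>r\<close> both vanish in the first
    \<open>k\<close> columns, so the swap preserves the reduced part. The case \<open>k = r\<close>
    is separate because a trivial swap does not change the sign of the determinant.\<close>
  have "swaprows k r P \<in> K"
  proof (cases "k = r")
    case True
    then have "swaprows k r P = P" by (intro eq_matI) auto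
    with True r step.prems show ?thesis by (auto intro: scale)
  next
    case False
    show ?thesis
      by (rule scale) (use False r step in \<open>auto simp: det_swaprows[of _ n]\<close>)
  qed
  then show ?case using r step by (intro swaprows_cancel_in[of P k r]) auto
qed

lemma invertible_in: "P \<in> carrier_mat n n \<Longrightarrow> det P \<noteq> 0 \<Longrightarrow> P \<in> K"
  by (rule invertible_in_aux[of 0]) auto

end

section \<open>Invertible combinations of two matrices\<close>

lemma smult_mat_mult_vec:
  fixes A :: "'a :: comm_ring mat"
  assumes "A \<in> carrier_mat n m" "v \<in> carrier_vec m"
  shows "(k \<cdot>\<^sub>m A) *\<^sub>v v = k \<cdot>\<^sub>v (A *\<^sub>v v)"
  using assms by (intro eq_vecI) auto

text \<open>
  Otherwise choose \<open>v t \<noteq> 0\<close> in the kernel of \<open>A + t C\<close>. The symmetry of \<open>A\<^sup>T C\<close> makes the vectors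
  \<open>C (v t)\<close> pairwise orthogonal, and injectivity makes them nonzero, for infinitely many \<open>t\<close>.
\<close>

lemma ex_det_add_smult_nonzero:
  fixes A C :: "real mat"
  assumes A: "A \<in> carrier_mat n n" and C: "C \<in> carrier_mat n n"
    and sym: "transpose_mat A * C = transpose_mat C * A"
    and inj: "\<And>v. v \<in> carrier_vec n \<Longrightarrow> A *\<^sub>v v = 0\<^sub>v n \<Longrightarrow> C *\<^sub>v v = 0\<^sub>v n \<Longrightarrow> v = 0\<^sub>v n"
  shows "\<exists>t. det (A + t \<cdot>\<^sub>m C) \<noteq> 0"
proof (rule ccontr)
  assume "\<not> ?thesis"
  then have "\<forall>t. \<exists>v. v \<in> carrier_vec n \<and> v \<noteq> 0\<^sub>v n \<and> (A + t \<cdot>\<^sub>m C) *\<^sub>v v = 0\<^sub>v n"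
    using A C det_0_iff_vec_prod_zero_field[of "A + _ \<cdot>\<^sub>m C" n] by simp
  then obtain v where v: "\<And>t. v t \<in> carrier_vec n" "\<And>t. v t \<noteq> 0\<^sub>v n"
      "\<And>t. (A + t \<cdot>\<^sub>m C) *\<^sub>v v t = 0\<^sub>v n"
    by metis
  define w where "w t = C *\<^sub>v v t" for t
  have w: "w t \<in> carrier_vec n" for t using C v by (simp add: w_def)
  have Av: "A *\<^sub>v v t = (- t) \<cdot>\<^sub>v w t" for t
  proof (rule eq_vecI)
    fix i assume i: "i < dim_vec ((- t) \<cdot>\<^sub>v w t)"
    then have i': "i < n" using w[of t] by simp
    have "((A + t \<cdot>\<^sub>m C) *\<^sub>v v t) $ i = (A *\<^sub>v v t) $ i + t * w t $ i"
      using i' A C v(1)[of t]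
      by (simp add: w_def add_mult_distrib_mat_vec[of _ n n] smult_mat_mult_vec[of _ n n] del: index_mult_mat_vec)
    then show "(A *\<^sub>v v t) $ i = ((- t) \<cdot>\<^sub>v w t) $ i"
      using v(3)[of t] i i' by simp
  qed (use A w[of t] in auto)
  have smult_zero: "k \<cdot>\<^sub>v 0\<^sub>v n = (0\<^sub>v n :: real vec)" for k
    by (intro eq_vecI) auto
  have w0: "w t \<noteq> 0\<^sub>v n" for t
    using inj[OF v(1)[of t]] v(2)[of t] Av[of t] by (auto simp: w_def smult_zero)
  have orth: "w s \<bullet> w t = 0" if "s \<noteq> t" for s t
  proof -
    have adj: "(M *\<^sub>v x) \<bullet> y = x \<bullet> (transpose_mat M *\<^sub>v y)"
      if "M \<in> carrier_mat n n" "x \<in> carrier_vec n" "y \<in> carrier_vec n" for M :: "real mat" and x y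
      using transpose_vec_mult_scalar[of "transpose_mat M" n n y x] that by simp
    \<comment> \<open>Evaluating this scalar product directly gives the factor \<open>- t\<close>;
      moving the matrices across by means of \<open>sym\<close> gives \<open>- s\<close>. Distinct
      parameters therefore force orthogonality.\<close>
    have "w s \<bullet> (A *\<^sub>v v t) = v s \<bullet> ((transpose_mat C * A) *\<^sub>v v t)"
      using A C v(1)
      by (simp add: w_def assoc_mult_mat_vec[of _ n n _ n] adj)
    also have "\<dots> = v s \<bullet> ((transpose_mat A * C) *\<^sub>v v t)" by (simp add: sym)
    also have "\<dots> = (A *\<^sub>v v s) \<bullet> w t"
      using A C v(1)
      by (simp add: w_def assoc_mult_mat_vec[of _ n n _ n] adj)
    finally have "(- t) * (w s \<bullet> w t) = (- s) * (w s \<bullet> w t)"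
      using w[of s] w[of t] by (simp add: Av)
    then show ?thesis using that by simp
  qed
  \<comment> \<open>The parameters 0, ..., n already suffice. The first n vectors are the rows of
    \<open>W\<close>; the Gram matrix \<open>W * transpose_mat W\<close> is diagonal with nonzero
    diagonal, so \<open>W\<close> is invertible. Yet \<open>w (real n)\<close> is nonzero and
    orthogonal to every row.\<close>
  define W where "W = mat n n (\<lambda>(i,j). w (real i) $ j)"
  have W: "W \<in> carrier_mat n n" by (simp add: W_def)
  have roww: "row W i = w (real i)" if "i < n" for i
    using that w[of "real i"] by (intro eq_vecI) (auto simp: W_def)
  have "upper_triangular (W * transpose_mat W)"
    using W by (intro upper_triangularI) (auto simp: roww orth)
  then have "det (W * transpose_mat W) = prod_list (diag_mat (W * transpose_mat W))"
    using W by (intro det_upper_triangular) auto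
  moreover have "0 \<notin> set (diag_mat (W * transpose_mat W))"
  proof -
    have "w t \<bullet> w t \<noteq> 0" for t
      using w0[of t] w[of t] conjugate_square_eq_0_vec[of "w t" n] by simp
    then show ?thesis using W by (auto simp: diag_mat_def roww)
  qed
  ultimately have "det (W * transpose_mat W) \<noteq> 0" by (simp add: prod_list_zero_iff)
  then have "det W \<noteq> 0" using W by (simp add: det_mult[of _ n])
  moreover have "W *\<^sub>v w (real n) = 0\<^sub>v n"
    using W by (intro eq_vecI) (auto simp: roww orth)
  ultimately show False
    using w0 w W det_0_iff_vec_prod_zero_field[of W n] by blast
qed

section \<open>The symplectic group\<close>

lemma four_block_mat_inject:
  assumes "A \<in> carrier_mat r1 c1" "B \<in> carrier_mat r1 c2" "C \<in> carrier_mat r2 c1" "D \<in> carrier_mat r2 c2"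
    and "A' \<in> carrier_mat r1 c1" "B' \<in> carrier_mat r1 c2" "C' \<in> carrier_mat r2 c1" "D' \<in> carrier_mat r2 c2"
  shows "four_block_mat A B C D = four_block_mat A' B' C' D' \<longleftrightarrow> A = A' \<and> B = B' \<and> C = C' \<and> D = D'"
proof
  assume eq: "four_block_mat A B C D = four_block_mat A' B' C' D'"
  have *: "four_block_mat A B C D $$ (i,j) = four_block_mat A' B' C' D' $$ (i,j)" for i j
    by (simp add: eq)
  have "A $$ (i,j) = A' $$ (i,j)" if "i < r1" "j < c1" for i j
    using *[of i j] that assms by simp
  moreover have "B $$ (i,j) = B' $$ (i,j)" if "i < r1" "j < c2" for i j
    using *[of i "j + c1"] that assms by simp
  moreover have "C $$ (i,j) = C' $$ (i,j)" if "i < r2" "j < c1" for i j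
    using *[of "i + r1" j] that assms by simp
  moreover have "D $$ (i,j) = D' $$ (i,j)" if "i < r2" "j < c2" for i j
    using *[of "i + r1" "j + c1"] that assms by simp
  ultimately show "A = A' \<and> B = B' \<and> C = C' \<and> D = D'"
    using assms by (intro conjI eq_matI) auto
qed simp

lemma uminus_zero_mat [simp]: "- 0\<^sub>m n m = (0\<^sub>m n m :: 'a :: group_add mat)"
  by (intro eq_matI) auto

lemma minus_mat_eq_zero_iff:
  fixes A B :: "'a :: ab_group_add mat"
  assumes "A \<in> carrier_mat n m" "B \<in> carrier_mat n m"
  shows "- B + A = 0\<^sub>m n m \<longleftrightarrow> A = B"
  using assms by (auto simp: mat_eq_iff)

lemma J_mat_carrier: "J_mat d \<in> carrier_mat (2 * d) (2 * d)"
  unfolding J_mat_def mult_2 by (rule four_block_carrier_mat) auto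

lemma J_mat_transpose_mult: "transpose_mat (J_mat d) * J_mat d = 1\<^sub>m (2 * d)"
proof -
  have "transpose_mat (J_mat d) = four_block_mat (0\<^sub>m d d) (- 1\<^sub>m d) (1\<^sub>m d) (0\<^sub>m d d)"
    unfolding J_mat_def
    by (subst transpose_four_block_mat[of _ d d _ d _ d])
      (auto intro!: cong_four_block_mat simp: transpose_uminus)
  then show ?thesis
    unfolding J_mat_def
    by (simp add: mult_four_block_mat[of _ d d _ d _ d _ _ d _ d] uminus_mult_left_mat uminus_mult_right_mat mult_2
        flip: four_block_one_mat)
qed

text \<open>Comparing blocks in H^T J H = J gives four equations. The lower left one is the negated
  transpose of the upper right one, which leaves three.\<close>

lemma symplectic_four_block_iff:
  assumes C: "A \<in> carrier_mat d d" "B \<in> carrier_mat d d" "C \<in> carrier_mat d d" "D \<in> carrier_mat d d"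
  shows "symplectic d (four_block_mat A B C D) \<longleftrightarrow>
    transpose_mat A * C = transpose_mat C * A \<and> transpose_mat B * D = transpose_mat D * B \<and>
    - (transpose_mat C * B) + transpose_mat A * D = 1\<^sub>m d"
proof -
  let ?H = "four_block_mat A B C D"
  have H: "?H \<in> carrier_mat (2 * d) (2 * d)"
    unfolding mult_2 by (rule four_block_carrier_mat) (use C in auto)
  have "transpose_mat ?H * J_mat d
      = four_block_mat (- transpose_mat C) (transpose_mat A) (- transpose_mat D) (transpose_mat B)"
    unfolding J_mat_def
    using C by (simp add: transpose_four_block_mat[of _ d d _ d _ d] mult_four_block_mat[of _ d d _ d _ d _ _ d _ d])
  then have eq: "transpose_mat ?H * J_mat d * ?H
      = four_block_mat (- (transpose_mat C * A) + transpose_mat A * C) (- (transpose_mat C * B) + transpose_mat A * D)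
          (- (transpose_mat D * A) + transpose_mat B * C) (- (transpose_mat D * B) + transpose_mat B * D)"
    using C by (simp add: mult_four_block_mat[of _ d d _ d _ d _ _ d _ d])
  have third: "- (transpose_mat D * A) + transpose_mat B * C = - 1\<^sub>m d"
    if "- (transpose_mat C * B) + transpose_mat A * D = 1\<^sub>m d"
  proof -
    have "- (transpose_mat D * A) + transpose_mat B * C
        = - transpose_mat (- (transpose_mat C * B) + transpose_mat A * D)"
      using C by (auto simp: transpose_add[of _ d d] transpose_uminus transpose_mult[of _ d d] mat_eq_iff)
    then show ?thesis by (simp add: that)
  qed
  show ?thesis
    unfolding symplectic_def eq
    unfolding J_mat_def
    by (subst four_block_mat_inject[of _ d d _ d _ d])
      (use C H third in \<open>auto simp: minus_mat_eq_zero_iff[of _ d d]\<close>)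
qed

section \<open>Group structure of the symplectic matrices\<close>

lemma SP_simps [simp]:
  "carrier (SP d) = {H. symplectic d H}" "x \<otimes>\<^bsub>SP d\<^esub> y = x * y" "\<one>\<^bsub>SP d\<^esub> = 1\<^sub>m (2 * d)"
  by (simp_all add: SP_def)

lemma symplectic_carrier: "symplectic d H \<Longrightarrow> H \<in> carrier_mat (2 * d) (2 * d)"
  by (simp add: symplectic_def)

lemma symplectic_mult:
  assumes "symplectic d H" "symplectic d K"
  shows "symplectic d (H * K)"
proof -
  have "transpose_mat (H * K) * J_mat d * (H * K) = transpose_mat K * (transpose_mat H * J_mat d * H) * K"
    using J_mat_carrier[of d] assms[THEN symplectic_carrier]
    by (simp add: transpose_mult[of _ "2*d" "2*d"] assoc_mult_mat[of _ "2*d" "2*d" _ "2*d" _ "2*d"])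
  with assms show ?thesis by (auto simp: symplectic_def)
qed

lemma symplectic_left_inverse:
  assumes "symplectic d H"
  shows "\<exists>K. symplectic d K \<and> K * H = 1\<^sub>m (2 * d)"
proof -
  note C = J_mat_carrier[of d] symplectic_carrier[OF assms]
  \<comment> \<open>Since J^-1 = J^T, solving H^T J H = J for the inverse of H gives J^T H^T
    J.\<close>
  let ?K = "transpose_mat (J_mat d) * transpose_mat H * J_mat d"
  have K: "?K \<in> carrier_mat (2*d) (2*d)"
    using C by auto
  have "?K * H = transpose_mat (J_mat d) * (transpose_mat H * J_mat d * H)"
    using C by (simp add: assoc_mult_mat[of _ "2*d" "2*d" _ "2*d" _ "2*d"])
  also have "\<dots> = 1\<^sub>m (2 * d)"
    using assms by (simp add: symplectic_def J_mat_transpose_mult)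
  finally have KH: "?K * H = 1\<^sub>m (2 * d)" .
  then have HK: "H * ?K = 1\<^sub>m (2 * d)" 
    by (rule mat_mult_left_right_inverse[OF K C(2)])
  \<comment> \<open>Replacing the inner J by H^T J H turns the expression into a congruence of J by
    \<open>H * ?K\<close>, which is the identity.\<close>
  have "transpose_mat ?K * J_mat d * ?K = transpose_mat ?K * (transpose_mat H * J_mat d * H) * ?K"
    using assms by (simp add: symplectic_def)
  also have "\<dots> = transpose_mat (H * ?K) * J_mat d * (H * ?K)"
    unfolding transpose_mult[OF C(2) K]
    using C transpose_carrier_mat[THEN iffD2, OF K] K
    by (simp add: assoc_mult_mat[of _ "2*d" "2*d" _ "2*d" _ "2*d"])
  also have "\<dots> = J_mat d" unfolding HK using C by simp
  finally have "symplectic d ?K" using K by (simp add: symplectic_def)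
  with KH show ?thesis by blast
qed

lemma group_SP: "group (SP d)"
proof (rule groupI)
  fix x y z assume "x \<in> carrier (SP d)" "y \<in> carrier (SP d)" "z \<in> carrier (SP d)"
  then show "x \<otimes>\<^bsub>SP d\<^esub> y \<otimes>\<^bsub>SP d\<^esub> z = x \<otimes>\<^bsub>SP d\<^esub> (y \<otimes>\<^bsub>SP d\<^esub> z)"
    by (auto dest!: symplectic_carrier intro: assoc_mult_mat)
next
  show "\<one>\<^bsub>SP d\<^esub> \<in> carrier (SP d)" using J_mat_carrier[of d] by (simp add: symplectic_def)
next
  fix x assume x: "x \<in> carrier (SP d)"
  then show "\<one>\<^bsub>SP d\<^esub> \<otimes>\<^bsub>SP d\<^esub> x = x"
    by (auto dest!: symplectic_carrier)
  from x show "\<exists>y\<in>carrier (SP d). y \<otimes>\<^bsub>SP d\<^esub> x = \<one>\<^bsub>SP d\<^esub>"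
    using symplectic_left_inverse by auto
qed (auto intro: symplectic_mult)

text \<open>With first block column (I, 0), the block equations reduce to D = I and B^T = B.
  Membership in \<open>L1 d\<close> can thus be read off from symplecticity without computing the
  right-hand blocks.\<close>

lemma L1_eq:
  "L1 d = {four_block_mat (1\<^sub>m d) B (0\<^sub>m d d) D | B D.
    B \<in> carrier_mat d d \<and> D \<in> carrier_mat d d \<and> symplectic d (four_block_mat (1\<^sub>m d) B (0\<^sub>m d d) D)}"
  by (fastforce simp: L1_def symplectic_four_block_iff)

lemma transpose_L1_eq:
  "transpose_mat ` L1 d = {four_block_mat (1\<^sub>m d) (0\<^sub>m d d) S (1\<^sub>m d) | S. S \<in> carrier_mat d d \<and> transpose_mat S = S}"
proof -
  have "transpose_mat (four_block_mat (1\<^sub>m d) S (0\<^sub>m d d) (1\<^sub>m d)) = four_block_mat (1\<^sub>m d) (0\<^sub>m d d) S (1\<^sub>m d)"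
    if "S \<in> carrier_mat d d" "transpose_mat S = S" for S :: "real mat"
    using that by (subst transpose_four_block_mat[of _ d d _ d _ d]) auto
  then show ?thesis unfolding L1_def by (force simp: image_iff)
qed

lemma SG_subset: "SG d \<subseteq> carrier (SP d)"
  unfolding SG_def transpose_L1_eq
  by (auto simp: L1_def symplectic_four_block_iff)

section \<open>Generation\<close>

lemma upper_in_generate:
  assumes "S \<in> carrier_mat d d" "transpose_mat S = S"
  shows "four_block_mat (1\<^sub>m d) S (0\<^sub>m d d) (1\<^sub>m d) \<in> generate (SP d) (SG d)"
  by (rule generate.incl) (use assms in \<open>auto simp: SG_def L1_def\<close>)

lemma lower_in_generate:
  assumes "S \<in> carrier_mat d d" "transpose_mat S = S"
  shows "four_block_mat (1\<^sub>m d) (0\<^sub>m d d) S (1\<^sub>m d) \<in> generate (SP d) (SG d)"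
  by (rule generate.incl) (use assms in \<open>auto simp: SG_def transpose_L1_eq\<close>)

lemma generate_mult:
  "x \<in> generate (SP d) (SG d) \<Longrightarrow> y \<in> generate (SP d) (SG d) \<Longrightarrow> x * y \<in> generate (SP d) (SG d)"
  using generate.eng[of x "SP d" "SG d" y] by simp

lemma generate_symplectic: "x \<in> generate (SP d) (SG d) \<Longrightarrow> symplectic d x"
  using group.generate_incl[OF group_SP SG_subset] by auto

lemma generate_cancel_left:
  assumes "x \<in> generate (SP d) (SG d)" "symplectic d y" "x * y \<in> generate (SP d) (SG d)"
  shows "y \<in> generate (SP d) (SG d)"
proof -
  interpret group "SP d" by (rule group_SP)
  have "inv\<^bsub>SP d\<^esub> x \<otimes>\<^bsub>SP d\<^esub> (x \<otimes>\<^bsub>SP d\<^esub> y) \<in> generate (SP d) (SG d)"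
    using generate.eng[OF generate_m_inv_closed[OF SG_subset assms(1)] assms(3)] by simp
  also have "inv\<^bsub>SP d\<^esub> x \<otimes>\<^bsub>SP d\<^esub> (x \<otimes>\<^bsub>SP d\<^esub> y) = y"
    using assms(2) generate_symplectic[OF assms(1)] by (subst inv_solve_left') (auto simp: symplectic_mult)
  finally show ?thesis .
qed

lemma generate_cancel_right:
  assumes "x \<in> generate (SP d) (SG d)" "symplectic d y" "y * x \<in> generate (SP d) (SG d)"
  shows "y \<in> generate (SP d) (SG d)"
proof -
  interpret group "SP d" by (rule group_SP)
  have "(y \<otimes>\<^bsub>SP d\<^esub> x) \<otimes>\<^bsub>SP d\<^esub> inv\<^bsub>SP d\<^esub> x \<in> generate (SP d) (SG d)"
    using generate.eng[OF assms(3) generate_m_inv_closed[OF SG_subset assms(1)]] by simp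
  also have "(y \<otimes>\<^bsub>SP d\<^esub> x) \<otimes>\<^bsub>SP d\<^esub> inv\<^bsub>SP d\<^esub> x = y"
    using assms(2) generate_symplectic[OF assms(1)] by (subst inv_solve_right') (auto simp: symplectic_mult)
  finally show ?thesis .
qed

section \<open>Antidiagonal and diagonal block matrices in the generated subgroup\<close>

lemma obtain_inverse_mat:
  fixes P :: "'a :: field mat"
  assumes "P \<in> carrier_mat n n" "det P \<noteq> 0"
  obtains Q where "Q \<in> carrier_mat n n" "P * Q = 1\<^sub>m n" "Q * P = 1\<^sub>m n"
  using det_non_zero_imp_unit[OF assms] by (auto simp: Units_def ring_mat_def)

text \<open>Here \<open>T\<close> is the inverse of \<open>S\<close>: I - S T = 0 clears the upper
  left block of U(S) L(-T), and I - T S = 0 clears the lower right block after the second factor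
  U(S).\<close>

lemma weyl_in_generate:
  assumes S: "S \<in> carrier_mat d d" "transpose_mat S = S"
    and T: "T \<in> carrier_mat d d" "transpose_mat T = T"
    and ST: "S * T = 1\<^sub>m d" "T * S = 1\<^sub>m d"
  shows "four_block_mat (0\<^sub>m d d) S (- T) (0\<^sub>m d d) \<in> generate (SP d) (SG d)"
proof -
  let ?U = "four_block_mat (1\<^sub>m d) S (0\<^sub>m d d) (1\<^sub>m d)"
  let ?L = "four_block_mat (1\<^sub>m d) (0\<^sub>m d d) (- T) (1\<^sub>m d)"
  have "?U * ?L = four_block_mat (0\<^sub>m d d) S (- T) (1\<^sub>m d)"
    using S T ST by (subst mult_four_block_mat[of _ d d _ d _ d _ _ d _ d]) auto
  then have "?U * ?L * ?U = four_block_mat (0\<^sub>m d d) S (- T) (0\<^sub>m d d)"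
    using S T ST by (simp add: mult_four_block_mat[of _ d d _ d _ d _ _ d _ d] uminus_l_inv_mat[of _ d d])
  moreover have "?U * ?L * ?U \<in> generate (SP d) (SG d)"
    using S T by (intro generate_mult upper_in_generate lower_in_generate) (auto simp: transpose_uminus)
  ultimately show ?thesis by simp
qed

lemma diag_symmetric_in_generate:
  assumes S: "S \<in> carrier_mat d d" "transpose_mat S = S"
    and T: "T \<in> carrier_mat d d" "transpose_mat T = T"
    and ST: "S * T = 1\<^sub>m d" "T * S = 1\<^sub>m d"
  shows "four_block_mat S (0\<^sub>m d d) (0\<^sub>m d d) T \<in> generate (SP d) (SG d)"
proof -
  \<comment> \<open>The double negation keeps the shape of \<open>weyl_in_generate\<close>, with -I
    in the role of both \<open>S\<close> and \<open>T\<close>.\<close>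
  let ?J = "four_block_mat (0\<^sub>m d d) (- 1\<^sub>m d) (- (- 1\<^sub>m d)) (0\<^sub>m d d) :: real mat"
  have "four_block_mat (0\<^sub>m d d) S (- T) (0\<^sub>m d d) * ?J \<in> generate (SP d) (SG d)"
    using S T ST by (intro generate_mult weyl_in_generate) (auto simp: transpose_uminus)
  also have "four_block_mat (0\<^sub>m d d) S (- T) (0\<^sub>m d d) * ?J = four_block_mat S (0\<^sub>m d d) (0\<^sub>m d d) T"
    using S T by (subst mult_four_block_mat[of _ d d _ d _ d _ _ d _ d]) auto
  finally show ?thesis .
qed

text \<open>The map from P to diag(P, P^-T) is multiplicative, so the matrices with generated image
  are closed under products. They include the invertible symmetric ones, hence all invertible
  ones.\<close>

lemma diag_in_generate:
  assumes P: "P \<in> carrier_mat d d" and Q: "Q \<in> carrier_mat d d" and PQ: "P * Q = 1\<^sub>m d"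
  shows "four_block_mat P (0\<^sub>m d d) (0\<^sub>m d d) (transpose_mat Q) \<in> generate (SP d) (SG d)"
proof -
  define K where "K = {P. \<exists>Q. P \<in> carrier_mat d d \<and> Q \<in> carrier_mat d d \<and> P * Q = 1\<^sub>m d \<and>
    four_block_mat P (0\<^sub>m d d) (0\<^sub>m d d) (transpose_mat Q) \<in> generate (SP d) (SG d)}"
  interpret symmetric_product_closed d K
  proof
    fix A B assume "A \<in> K" "B \<in> K"
    then obtain A' B' where
      A: "A \<in> carrier_mat d d" "A' \<in> carrier_mat d d" "A * A' = 1\<^sub>m d"
        "four_block_mat A (0\<^sub>m d d) (0\<^sub>m d d) (transpose_mat A') \<in> generate (SP d) (SG d)" and
      B: "B \<in> carrier_mat d d" "B' \<in> carrier_mat d d" "B * B' = 1\<^sub>m d"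
        "four_block_mat B (0\<^sub>m d d) (0\<^sub>m d d) (transpose_mat B') \<in> generate (SP d) (SG d)"
      unfolding K_def by blast
    have "A * B * (B' * A') = A * (B * B') * A'"
      using A(1,2) B(1,2) by (simp add: assoc_mult_mat[of _ d d _ d _ d])
    then have "A * B * (B' * A') = 1\<^sub>m d" using A B by simp
    moreover have "four_block_mat (A * B) (0\<^sub>m d d) (0\<^sub>m d d) (transpose_mat (B' * A'))
        = four_block_mat A (0\<^sub>m d d) (0\<^sub>m d d) (transpose_mat A') * four_block_mat B (0\<^sub>m d d) (0\<^sub>m d d) (transpose_mat B')"
      using A(1,2) B(1,2)
      by (subst mult_four_block_mat[of _ d d _ d _ d _ _ d _ d]) (auto simp: transpose_mult[of _ d d])
    ultimately show "A * B \<in> K"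
      using A B generate_mult[OF A(4) B(4)] unfolding K_def
      by (auto intro!: exI[of _ "B' * A'"])
  next
    fix S :: "real mat" assume S: "S \<in> carrier_mat d d" "transpose_mat S = S" "det S \<noteq> 0"
    then obtain T where T: "T \<in> carrier_mat d d" "S * T = 1\<^sub>m d" "T * S = 1\<^sub>m d"
      using obtain_inverse_mat by blast
    \<comment> \<open>Transposing \<open>S * T = 1\<^sub>m d\<close> shows that
      \<open>transpose_mat T\<close> is also an inverse of \<open>S\<close>, so it equals
      \<open>T\<close>.\<close>
    have "transpose_mat T * S = 1\<^sub>m d"
      using transpose_mult[OF S(1) T(1)] T S by simp
    then have "transpose_mat T * S * T = T" using T by simp
    then have "transpose_mat T = T"
      using S T by (simp add: assoc_mult_mat[of _ d d _ d _ d])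
    then show "S \<in> K"
      using S T diag_symmetric_in_generate[of S d T] by (auto simp: K_def intro!: exI[of _ T])
  qed
  have "det P \<noteq> 0"
    using det_mult[OF P Q] PQ by auto
  then obtain Q' where Q': "Q' \<in> carrier_mat d d" "P * Q' = 1\<^sub>m d"
      "four_block_mat P (0\<^sub>m d d) (0\<^sub>m d d) (transpose_mat Q') \<in> generate (SP d) (SG d)"
    using invertible_in[OF P] by (auto simp: K_def)
  \<comment> \<open>Membership in \<open>K\<close> supplies only some right inverse
    \<open>Q'\<close>; uniqueness of inverses identifies it with the given \<open>Q\<close>.\<close>
  have "Q' = Q * P * Q'"
    using Q' mat_mult_left_right_inverse[OF P Q PQ] by simp
  also have "\<dots> = Q"
    using P Q Q' by (simp add: assoc_mult_mat[of _ d d _ d _ d])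
  finally show ?thesis using Q' by simp
qed

text \<open>Block elimination: L(-C A^-1) clears the lower left block, then diag(A^-1, A^T) turns
  the corner into I. The result lies in \<open>L1 d\<close>, and the two generated factors are
  cancelled.\<close>

lemma invertible_corner_in_generate:
  assumes C: "A \<in> carrier_mat d d" "B \<in> carrier_mat d d" "C \<in> carrier_mat d d" "D \<in> carrier_mat d d"
    and H: "symplectic d (four_block_mat A B C D)" and det: "det A \<noteq> 0"
  shows "four_block_mat A B C D \<in> generate (SP d) (SG d)"
proof -
  note assoc = assoc_mult_mat[of _ d d _ d _ d]
  obtain Q where Q: "Q \<in> carrier_mat d d" "A * Q = 1\<^sub>m d" "Q * A = 1\<^sub>m d"
    using obtain_inverse_mat[OF C(1) det] by blast
  have QA: "transpose_mat Q * transpose_mat A = 1\<^sub>m d"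
    using transpose_mult[OF C(1) Q(1)] Q by simp
  \<comment> \<open>A lower factor is available only for a symmetric block. The symmetry of
    \<open>C * Q\<close> comes from A^T C = C^T A, multiplied by Q^T on the left and Q on the
    right.\<close>
  have "C * Q = transpose_mat Q * transpose_mat A * (C * Q)"
    using C Q by (simp add: QA)
  also have "\<dots> = transpose_mat Q * (transpose_mat A * C) * Q"
    using C Q by (simp add: assoc)
  also have "transpose_mat A * C = transpose_mat C * A"
    using H C by (simp add: symplectic_four_block_iff)
  also have "transpose_mat Q * (transpose_mat C * A) * Q = transpose_mat (C * Q) * (A * Q)"
    using C(1,3) Q(1) by (simp add: assoc transpose_mult[of _ d d])
  finally have sym: "transpose_mat (C * Q) = C * Q" using C Q by simp
  let ?L = "four_block_mat (1\<^sub>m d) (0\<^sub>m d d) (- (C * Q)) (1\<^sub>m d)"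
  let ?D = "four_block_mat Q (0\<^sub>m d d) (0\<^sub>m d d) (transpose_mat A)"
  let ?H = "four_block_mat A B C D"
  have L: "?L \<in> generate (SP d) (SG d)"
    using C Q sym by (intro lower_in_generate) (auto simp: transpose_uminus)
  have D: "?D \<in> generate (SP d) (SG d)"
    using C Q by (intro diag_in_generate) auto
  have LH: "?L * ?H = four_block_mat A B (0\<^sub>m d d) (- (C * Q * B) + D)"
    using C Q
    by (subst mult_four_block_mat[of _ d d _ d _ d _ _ d _ d]) (auto simp: assoc uminus_l_inv_mat[of _ d d])
  then have DLH: "?D * (?L * ?H)
      = four_block_mat (1\<^sub>m d) (Q * B) (0\<^sub>m d d) (transpose_mat A * (- (C * Q * B) + D))"
    using C Q by (simp add: mult_four_block_mat[of _ d d _ d _ d _ _ d _ d])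
  have LHs: "symplectic d (?L * ?H)"
    by (rule symplectic_mult[OF generate_symplectic[OF L] H])
  have "symplectic d (?D * (?L * ?H))"
    by (rule symplectic_mult[OF generate_symplectic[OF D] LHs])
  \<comment> \<open>The lower right block is left unsimplified: by \<open>L1_eq\<close>,
    symplecticity forces it to be the identity and \<open>Q * B\<close> to be symmetric.\<close>
  then have "?D * (?L * ?H) \<in> L1 d"
    unfolding L1_eq DLH using C Q by fastforce
  then have "?D * (?L * ?H) \<in> generate (SP d) (SG d)"
    by (intro generate.incl) (simp add: SG_def)
  then show ?thesis
    using generate_cancel_left[OF D LHs] generate_cancel_left[OF L H] by blast
qed

text \<open>Left multiplication by U(t I) changes the corner to A + t C, which is invertible for a
  suitable t; the factor is then cancelled.\<close>

lemma symplectic_in_generate: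
  assumes H: "symplectic d H"
  shows "H \<in> generate (SP d) (SG d)"
proof -
  obtain A B C D where "split_block H d d = (A, B, C, D)" by (metis prod_cases4)
  from split_block[OF this, of d d] symplectic_carrier[OF H]
  have C: "A \<in> carrier_mat d d" "B \<in> carrier_mat d d" "C \<in> carrier_mat d d" "D \<in> carrier_mat d d"
    and H_eq: "H = four_block_mat A B C D"
    by auto
  note sp = H[unfolded H_eq symplectic_four_block_iff[OF C]]
  have "\<exists>t. det (A + t \<cdot>\<^sub>m C) \<noteq> 0"
  proof (rule ex_det_add_smult_nonzero)
    fix v assume v: "v \<in> carrier_vec d" "A *\<^sub>v v = 0\<^sub>v d" "C *\<^sub>v v = 0\<^sub>v d"
    \<comment> \<open>The transposed block relation D^T A - B^T C = I, applied to a common kernel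
      vector of \<open>A\<close> and \<open>C\<close>, shows that this vector is zero.\<close>
    have "1\<^sub>m d = transpose_mat (- (transpose_mat C * B) + transpose_mat A * D)"
      using sp by simp
    also have "\<dots> = - (transpose_mat B * C) + transpose_mat D * A"
      using C by (simp add: transpose_add[of _ d d] transpose_uminus transpose_mult[of _ d d])
    finally have "v = (- (transpose_mat B * C) + transpose_mat D * A) *\<^sub>v v"
      using v one_mult_mat_vec by metis
    also have "\<dots> = - (transpose_mat B *\<^sub>v (C *\<^sub>v v)) + transpose_mat D *\<^sub>v (A *\<^sub>v v)"
      using C v(1)
      by (simp add: add_mult_distrib_mat_vec[of _ d d] assoc_mult_mat_vec[of _ d d _ d])
    also have "\<dots> = 0\<^sub>v d" using C v by (intro eq_vecI) auto
    finally show "v = 0\<^sub>v d" .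
  qed (use C sp in auto)
  then obtain t where t: "det (A + t \<cdot>\<^sub>m C) \<noteq> 0" ..
  let ?U = "four_block_mat (1\<^sub>m d) (t \<cdot>\<^sub>m 1\<^sub>m d) (0\<^sub>m d d) (1\<^sub>m d)"
  have U: "?U \<in> generate (SP d) (SG d)"
    by (rule upper_in_generate) (auto simp: mat_eq_iff)
  have UH: "?U * H = four_block_mat (A + t \<cdot>\<^sub>m C) (B + t \<cdot>\<^sub>m D) C D"
    unfolding H_eq using C
    by (subst mult_four_block_mat[of _ d d _ d _ d _ _ d _ d]) (auto simp: mult_smult_assoc_mat[of _ d d])
  have "symplectic d (?U * H)"
    by (intro symplectic_mult generate_symplectic[OF U] H)
  then have "?U * H \<in> generate (SP d) (SG d)"
    unfolding UH using C t by (intro invertible_corner_in_generate) auto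
  then show ?thesis by (rule generate_cancel_left[OF U H])
qed

theorem corollary3:
  fixes d :: nat
  shows "group (SP d) \<and> SG d \<subseteq> carrier (SP d) \<and> generate (SP d) (SG d) = carrier (SP d)"
  using group_SP SG_subset generate_symplectic symplectic_in_generate by auto

end
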